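(* Let $P$ be a physical property of states in $\mathcal{D}(\mathcal{H})$, let $\mathscr{C}\subseteq\mathcal{D}(\mathcal{H})$ be the set of all states that lack $P$, let $\widehat{A}$ be an observable on $\mathcal{H}$, and let $A_{\min,\mathscr{C}}:=\min_{\rho\in\mathscr{C}}\operatorname{Tr}[\rho\widehat{A}]$. Then the operator $$Z^{\mathrm{PW}} := \widehat{A}-A_{\min,\mathscr{C}}\,\mathbb{1}$$ acts as a proxy witness operator for $P$: $\operatorname{Tr}[\rho Z^{\mathrm{PW}}]\ge 0$ for all $\rho\in\mathscr{C}$, and if a state $\xi\in\mathcal{D}(\mathcal{H})$ satisfies $\operatorname{Tr}[\xi Z^{\mathrm{PW}}]<0$, then $\xi$ has the property $P$.
   Context: $\mathcal{D}(\mathcal{H})$ is the set of density operators on the Hilbert space $\mathcal{H}$. A property $P$ is identified with a partition of $\mathcal{D}(\mathcal{H})$ into the set $\mathscr{C}$ of states lacking $P$ and its complement $\overline{\mathscr{C}}=\mathcal{D}(\mathcal{H})\setminus\mathscr{C}$ of states having $P$. An observable is a Hermitian operator; the minimum defining $A_{\min,\mathscr{C}}$ is assumed to exist. *)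

theory Defs
  imports "HOL-Analysis.Analysis"
begin

text \<open>
  The complex inner product is conjugate-linear in its first argument (bra) and linear in its
  second (ket). The norm and topology are those of the underlying real normed space.
\<close>

class chilbert_space = real_normed_vector + complete_space +
  fixes scaleC :: "complex \<Rightarrow> 'a \<Rightarrow> 'a" (infixr "*\<^sub>C" 75)
    and cinner :: "'a \<Rightarrow> 'a \<Rightarrow> complex"
  assumes scaleR_scaleC: "scaleR r x = complex_of_real r *\<^sub>C x"
    and scaleC_add_right: "a *\<^sub>C (x + y) = a *\<^sub>C x + a *\<^sub>C y"
    and scaleC_add_left: "(a + b) *\<^sub>C x = a *\<^sub>C x + b *\<^sub>C x"
    and scaleC_scaleC: "a *\<^sub>C (b *\<^sub>C x) = (a * b) *\<^sub>C x"
    and cinner_commute: "cinner x y = cnj (cinner y x)"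
    and cinner_add_right: "cinner x (y + z) = cinner x y + cinner x z"
    and cinner_scaleC_right: "cinner x (a *\<^sub>C y) = a * cinner x y"
    and cinner_self: "cinner x x = complex_of_real ((norm x)\<^sup>2)"

instantiation complex :: chilbert_space
begin

definition scaleC_complex :: "complex \<Rightarrow> complex \<Rightarrow> complex"
  where "scaleC_complex a x = a * x"

definition cinner_complex :: "complex \<Rightarrow> complex \<Rightarrow> complex"
  where "cinner_complex x y = cnj x * y"

instance
proof
  fix r :: real and a b x y z :: complex
  show "scaleR r x = complex_of_real r *\<^sub>C x"
    unfolding scaleC_complex_def by (rule scaleR_conv_of_real)
  show "a *\<^sub>C (x + y) = a *\<^sub>C x + a *\<^sub>C y"
    unfolding scaleC_complex_def by (rule distrib_left)
  show "(a + b) *\<^sub>C x = a *\<^sub>C x + b *\<^sub>C x"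
    unfolding scaleC_complex_def by (rule distrib_right)
  show "a *\<^sub>C (b *\<^sub>C x) = (a * b) *\<^sub>C x"
    by (simp add: scaleC_complex_def)
  show "cinner x y = cnj (cinner y x)"
    by (simp add: cinner_complex_def)
  show "cinner x (y + z) = cinner x y + cinner x z"
    unfolding cinner_complex_def by (rule distrib_left)
  show "cinner x (a *\<^sub>C y) = a * cinner x y"
    by (simp add: cinner_complex_def scaleC_complex_def)
  show "cinner x x = complex_of_real ((norm x)\<^sup>2)"
    unfolding cinner_complex_def complex_norm_square by (rule mult.commute)
qed

end

instantiation vec :: (chilbert_space, finite) chilbert_space
begin

definition scaleC_vec :: "complex \<Rightarrow> 'a ^ 'b \<Rightarrow> 'a ^ 'b"
  where "scaleC_vec a x = (\<chi> i. a *\<^sub>C (x $ i))"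

definition cinner_vec :: "'a ^ 'b \<Rightarrow> 'a ^ 'b \<Rightarrow> complex"
  where "cinner_vec x y = (\<Sum>i\<in>UNIV. cinner (x $ i) (y $ i))"

instance
proof
  fix r :: real and a b :: complex and x y z :: "'a ^ 'b"
  show "scaleR r x = complex_of_real r *\<^sub>C x"
    by (simp add: scaleC_vec_def vec_eq_iff scaleR_scaleC)
  show "a *\<^sub>C (x + y) = a *\<^sub>C x + a *\<^sub>C y"
    by (simp add: scaleC_vec_def vec_eq_iff scaleC_add_right)
  show "(a + b) *\<^sub>C x = a *\<^sub>C x + b *\<^sub>C x"
    by (simp add: scaleC_vec_def vec_eq_iff scaleC_add_left)
  show "a *\<^sub>C (b *\<^sub>C x) = (a * b) *\<^sub>C x"
    by (simp add: scaleC_vec_def vec_eq_iff scaleC_scaleC)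
  show "cinner x y = cnj (cinner y x)"
    unfolding cinner_vec_def cnj_sum by (intro sum.cong refl cinner_commute)
  show "cinner x (y + z) = cinner x y + cinner x z"
    by (simp add: cinner_vec_def cinner_add_right sum.distrib)
  show "cinner x (a *\<^sub>C y) = a * cinner x y"
    by (simp add: cinner_vec_def scaleC_vec_def cinner_scaleC_right sum_distrib_left)
  show "cinner x x = complex_of_real ((norm x)\<^sup>2)"
    by (simp add: cinner_vec_def norm_vec_def L2_set_def cinner_self sum_nonneg)
qed

end

text \<open>
  Operators are everywhere-defined complex-linear maps. Boundedness is not required explicitly:
  by the Hellinger--Toeplitz theorem it is automatic for Hermitian, hence also for positive,
  everywhere-defined operators.
\<close>

abbreviation clinear :: "('h::chilbert_space \<Rightarrow> 'h) \<Rightarrow> bool"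
  where "clinear \<equiv> Vector_Spaces.linear scaleC scaleC"

definition hermitian :: "('h::chilbert_space \<Rightarrow> 'h) \<Rightarrow> bool"
  where "hermitian A \<longleftrightarrow> clinear A \<and> (\<forall>x y. cinner (A x) y = cinner x (A y))"

text \<open>The order on complex numbers used here implies that the quantity is real.\<close>

definition positive_op :: "('h::chilbert_space \<Rightarrow> 'h) \<Rightarrow> bool"
  where "positive_op A \<longleftrightarrow> clinear A \<and> (\<forall>x. 0 \<le> cinner x (A x))"

definition orthonormal_basis :: "'h::chilbert_space set \<Rightarrow> bool"
  where "orthonormal_basis B \<longleftrightarrow>
    (\<forall>e\<in>B. \<forall>f\<in>B. cinner e f = (if e = f then 1 else 0)) \<and>
    (\<forall>x. (\<forall>e\<in>B. cinner e x = 0) \<longrightarrow> x = 0)"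

text \<open>
  The sum converges unconditionally, to the same value, for every orthonormal basis; for bounded
  operators this is equivalent to being trace class. A positive operator with a trace in this sense
  is exactly a positive trace-class operator.
\<close>

definition has_trace :: "('h::chilbert_space \<Rightarrow> 'h) \<Rightarrow> complex \<Rightarrow> bool"
  where "has_trace T t \<longleftrightarrow> (\<forall>B. orthonormal_basis B \<longrightarrow> ((\<lambda>e. cinner e (T e)) has_sum t) B)"

definition Tr :: "('h::chilbert_space \<Rightarrow> 'h) \<Rightarrow> complex"
  where "Tr T = (THE t. has_trace T t)"

definition density_operators :: "('h::chilbert_space \<Rightarrow> 'h) set"
  where "density_operators = {\<rho>. positive_op \<rho> \<and> has_trace \<rho> 1}"

definition states_lacking ::
    "(('h::chilbert_space \<Rightarrow> 'h) \<Rightarrow> bool) \<Rightarrow> ('h \<Rightarrow> 'h) set"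
  where "states_lacking P = {\<rho> \<in> density_operators. \<not> P \<rho>}"

text \<open>
  Least element of the set of expectation values over \<open>C\<close>, in the order on complex
  numbers; meaningful when the minimum is attained.
\<close>

definition min_expectation ::
    "('h::chilbert_space \<Rightarrow> 'h) \<Rightarrow> ('h \<Rightarrow> 'h) set \<Rightarrow> complex"
  where "min_expectation A C = (LEAST m. m \<in> (\<lambda>\<rho>. Tr (\<rho> \<circ> A)) ` C)"

definition Z_PW ::
    "('h::chilbert_space \<Rightarrow> 'h) \<Rightarrow> ('h \<Rightarrow> 'h) set \<Rightarrow> 'h \<Rightarrow> 'h"
  where "Z_PW A C = (\<lambda>x. A x - min_expectation A C *\<^sub>C x)"

end

theory Submission
  imports Defs
begin

text \<open>
  Once \<open>Tr (\<rho> \<circ> A)\<close> is known to exist, linearity of the trace and \<open>Tr \<rho> = 1\<close> turn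
  \<open>Tr (\<rho> \<circ> Z)\<close> into \<open>Tr (\<rho> \<circ> A)\<close> minus its minimum, and both claims are immediate.
  In infinite dimension existence is the substance. Polarization expresses
  \<open>\<langle>e, \<rho> A e\<rangle>\<close> through values \<open>\<langle>S e, \<rho> S e\<rangle>\<close> with \<open>S\<close> among \<open>1\<close>, \<open>A\<close>, \<open>1 + A\<close>, \<open>1 + \<i>A\<close>,
  all bounded by Hellinger--Toeplitz. Finite partial sums of \<open>\<langle>S e, \<rho> S e\<rangle>\<close> over any orthonormal
  basis are at most \<open>\<parallel>S\<parallel>\<^sup>2\<close> times the sum of \<open>\<langle>e, \<rho> e\<rangle>\<close> over any other. This is proved without
  square roots by splitting rank-one operators off \<open>\<rho>\<close>: each satisfies the bound by Bessel and
  Parseval, and the remainder has arbitrarily small trace. Applied to the positive operator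
  \<open>S* \<rho> S\<close> itself, with the identity in place of \<open>S\<close>, the bound gives basis independence.
\<close>

section \<open>Inner product spaces\<close>

text \<open>\<open>Vector_Spaces.linear\<close> carries the vector space axioms for both scalar
  multiplications. Discharging them once, with the unit law taken from \<open>scaleR_scaleC\<close>,
  leaves additivity and homogeneity.\<close>

lemma clinear_iff:
  fixes A :: "'h::chilbert_space \<Rightarrow> 'h"
  shows "clinear A \<longleftrightarrow> (\<forall>x y. A (x + y) = A x + A y) \<and> (\<forall>c x. A (c *\<^sub>C x) = c *\<^sub>C A x)"
proof -
  have "1 *\<^sub>C x = x" for x :: 'h
    using scaleR_scaleC[of 1 x] by simp
  then have "vector_space (scaleC :: complex \<Rightarrow> 'h \<Rightarrow> 'h)"
    by unfold_locales (simp_all add: scaleC_add_right scaleC_add_left scaleC_scaleC)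
  then show ?thesis
    by (simp add: Vector_Spaces.linear_iff)
qed

lemma scaleC_one [simp]: "1 *\<^sub>C x = x" for x :: "'h::chilbert_space"
  using scaleR_scaleC[of 1 x] by simp

lemma scaleC_zero_left [simp]: "0 *\<^sub>C x = 0" for x :: "'h::chilbert_space"
  using scaleR_scaleC[of 0 x] by simp

lemma cinner_add_left: "cinner (x + y) z = cinner x z + cinner y z"
  for x y z :: "'h::chilbert_space"
  by (metis cinner_add_right cinner_commute complex_cnj_add)

lemma cinner_scaleC_left: "cinner (c *\<^sub>C x) y = cnj c * cinner x y"
  for x y :: "'h::chilbert_space"
  by (metis cinner_scaleC_right cinner_commute complex_cnj_mult)

lemma cinner_zero_right [simp]: "cinner x 0 = 0" for x :: "'h::chilbert_space"
  using cinner_add_right[of x 0 0] by simp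

lemma cinner_zero_left [simp]: "cinner 0 x = 0" for x :: "'h::chilbert_space"
  using cinner_add_left[of 0 0 x] by simp

lemma cinner_minus_right [simp]: "cinner x (- y) = - cinner x y"
  for x y :: "'h::chilbert_space"
  using cinner_add_right[of x y "- y"] by (simp add: eq_neg_iff_add_eq_0 add.commute)

lemma cinner_minus_left [simp]: "cinner (- x) y = - cinner x y"
  for x y :: "'h::chilbert_space"
  using cinner_add_left[of x "- x" y] by (simp add: eq_neg_iff_add_eq_0 add.commute)

lemma cinner_diff_right: "cinner x (y - z) = cinner x y - cinner x z"
  for x y z :: "'h::chilbert_space"
  using cinner_add_right[of x y "- z"] by simp

lemma cinner_diff_left: "cinner (x - y) z = cinner x z - cinner y z"
  for x y z :: "'h::chilbert_space"
  using cinner_add_left[of x "- y" z] by simp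

lemma cinner_sum_right: "cinner x (sum f F) = (\<Sum>i\<in>F. cinner x (f i))"
  for x :: "'h::chilbert_space"
  by (induction F rule: infinite_finite_induct) (simp_all add: cinner_add_right)

lemma cinner_sum_left: "cinner (sum f F) x = (\<Sum>i\<in>F. cinner (f i) x)"
  for x :: "'h::chilbert_space"
  by (induction F rule: infinite_finite_induct) (simp_all add: cinner_add_left)

text \<open>A normed space gives homogeneity for real scalars; for complex ones it is read off from
  the squared norm via \<open>cinner_self\<close>.\<close>

lemma norm_scaleC [simp]: "norm (c *\<^sub>C x) = norm c * norm x" for x :: "'h::chilbert_space"
proof -
  have "complex_of_real ((norm (c *\<^sub>C x))\<^sup>2) = complex_of_real ((norm c * norm x)\<^sup>2)"
    unfolding cinner_self[symmetric] cinner_scaleC_left cinner_scaleC_right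
    by (simp add: cinner_self power_mult_distrib complex_norm_square mult_ac flip: of_real_power)
  then have "(norm (c *\<^sub>C x))\<^sup>2 = (norm c * norm x)\<^sup>2"
    by (simp only: of_real_eq_iff)
  then show ?thesis
    by (simp add: power2_eq_iff_nonneg)
qed

lemma norm_cinner_commute: "norm (cinner x y) = norm (cinner y x)" for x y :: "'h::chilbert_space"
  by (metis cinner_commute complex_mod_cnj)

section \<open>Positive operators\<close>

text \<open>Real-valued, so that suprema and monotone bounds on sums are available. For positive
  operators the imaginary part dropped by \<open>Re\<close> is zero
  (\<open>cinner_eq_qform\<close>).\<close>

definition qform :: "('h::chilbert_space \<Rightarrow> 'h) \<Rightarrow> 'h \<Rightarrow> real"
  where "qform T x = Re (cinner x (T x))"

lemma positive_opD:
  fixes T :: "'h::chilbert_space \<Rightarrow> 'h"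
  assumes "positive_op T"
  shows positive_op_add: "T (x + y) = T x + T y"
    and positive_op_scaleC: "T (c *\<^sub>C x) = c *\<^sub>C T x"
    and qform_nonneg: "0 \<le> qform T x"
    and cinner_eq_qform: "cinner x (T x) = complex_of_real (qform T x)"
  using assms
  by (auto simp: positive_op_def clinear_iff qform_def less_eq_complex_def complex_eq_iff)

lemma positive_opI:
  fixes T :: "'h::chilbert_space \<Rightarrow> 'h"
  assumes "\<And>x y. T (x + y) = T x + T y" "\<And>c x. T (c *\<^sub>C x) = c *\<^sub>C T x"
    and "\<And>x. cinner x (T x) = complex_of_real (q x)" "\<And>x. 0 \<le> q x"
  shows "positive_op T"
  using assms by (simp add: positive_op_def clinear_iff less_eq_complex_def)

text \<open>Reality of the quadratic form at \<open>x + y\<close> relates the imaginary parts of the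
  mixed terms, and at \<open>x + \<i> *\<^sub>C y\<close> the real parts; together they say that the
  mixed terms are conjugate.\<close>

lemma positive_op_symmetric:
  fixes T :: "'h::chilbert_space \<Rightarrow> 'h"
  assumes T: "positive_op T"
  shows "cinner (T x) y = cinner x (T y)"
proof -
  have im: "Im (cinner z (T z)) = 0" for z
    by (simp add: cinner_eq_qform[OF T])
  have "Im (cinner x (T y)) + Im (cinner y (T x)) = 0"
    using im[of "x + y"] by (simp add: positive_op_add[OF T] cinner_add_left cinner_add_right im)
  moreover have "Re (cinner x (T y)) - Re (cinner y (T x)) = 0"
    using im[of "x + \<i> *\<^sub>C y"]
    by (simp add: positive_op_add[OF T] positive_op_scaleC[OF T] cinner_add_left cinner_add_right
        cinner_scaleC_left cinner_scaleC_right im)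
  ultimately show ?thesis
    by (subst cinner_commute) (simp add: complex_eq_iff)
qed

text \<open>Used twice: with a variable multiple \<open>c\<close> for Cauchy--Schwarz, and with
  \<open>c = 1\<close> and \<open>c = \<i>\<close> for polarization.\<close>

lemma qform_add_scaleC:
  fixes T :: "'h::chilbert_space \<Rightarrow> 'h"
  assumes T: "positive_op T"
  shows "qform T (x + c *\<^sub>C y) = qform T x + 2 * Re (c * cinner x (T y)) + (norm c)\<^sup>2 * qform T y"
proof -
  have "cinner (c *\<^sub>C y) (T x) = cnj (c * cinner x (T y))"
    by (metis positive_op_symmetric[OF T] cinner_commute positive_op_scaleC[OF T] cinner_scaleC_right)
  moreover have "complex_of_real (qform T (c *\<^sub>C y)) = complex_of_real ((norm c)\<^sup>2 * qform T y)"
    unfolding cinner_eq_qform[OF T, symmetric] by (simp add: positive_op_scaleC[OF T] cinner_scaleC_left cinner_scaleC_right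
        cinner_eq_qform[OF T] complex_norm_square[unfolded of_real_power] mult_ac)
  then have "qform T (c *\<^sub>C y) = (norm c)\<^sup>2 * qform T y"
    by (simp only: of_real_eq_iff)
  moreover have "cinner x (T (c *\<^sub>C y)) = c * cinner x (T y)"
    by (simp add: positive_op_scaleC[OF T] cinner_scaleC_right)
  ultimately show ?thesis
    by (simp add: qform_def[of T "x + _"] positive_op_add[OF T] cinner_add_left cinner_add_right
        cinner_eq_qform[OF T] del: times_complex.sel complex_cnj_mult of_real_mult of_real_power)
qed

lemma qform_Cauchy_Schwarz:
  fixes T :: "'h::chilbert_space \<Rightarrow> 'h"
  assumes T: "positive_op T"
  shows "(norm (cinner x (T y)))\<^sup>2 \<le> qform T x * qform T y"
proof -
  define h where "h = (norm (cinner x (T y)))\<^sup>2"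
  \<comment> \<open>The coefficient \<open>r * cnj (cinner x (T y))\<close> makes the mixed term
    real, leaving a real quadratic in \<open>r\<close>.\<close>
  have quad: "0 \<le> qform T x + 2 * r * h + r\<^sup>2 * h * qform T y" for r
  proof -
    have "qform T (x + (complex_of_real r * cnj (cinner x (T y))) *\<^sub>C y)
      = qform T x + 2 * r * h + r\<^sup>2 * h * qform T y"
    proof -
      have "complex_of_real r * cnj (cinner x (T y)) * cinner x (T y) = complex_of_real (r * h)"
        by (simp add: h_def complex_norm_square[unfolded of_real_power] mult_ac)
      then show ?thesis
        unfolding qform_add_scaleC[OF T] by (simp only: Re_complex_of_real)
          (simp add: norm_mult power_mult_distrib h_def)
    qed
    then show ?thesis
      using qform_nonneg[OF T] by metis
  qed
  have h0: "h \<ge> 0"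
    by (simp add: h_def)
  show ?thesis
  proof (cases "qform T y = 0")
    case True
    have "h = 0"
    proof (rule ccontr)
      assume "h \<noteq> 0"
      \<comment> \<open>The quadratic is now affine in \<open>r\<close>; the chosen \<open>r\<close>
        gives it the value -1.\<close>
      then show False
        using quad[of "- (qform T x + 1) / (2 * h)"] True by (simp add: field_simps)
    qed
    then show ?thesis
      using True h_def by simp
  next
    case False
    then have p: "qform T y > 0"
      using qform_nonneg[OF T, of y] by simp
    \<comment> \<open>\<open>r = - 1 / qform T y\<close> minimizes the quadratic.\<close>
    have "0 \<le> qform T x - h / qform T y"
      using quad[of "- 1 / qform T y"] p by (simp add: power2_eq_square field_simps)
    then show ?thesis
      using p by (simp add: h_def field_simps)
  qed
qed

text \<open>Makes the ordinary Cauchy--Schwarz inequality an instance of the one for positive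
  operators.\<close>

lemma positive_op_id: "positive_op (\<lambda>x :: 'h::chilbert_space. x)"
  by (rule positive_opI[where q = "\<lambda>x. (norm x)\<^sup>2"]) (simp_all add: cinner_self)

lemma norm_cinner_le: "norm (cinner x y) \<le> norm x * norm y" for x y :: "'h::chilbert_space"
proof (rule power2_le_imp_le)
  show "(norm (cinner x y))\<^sup>2 \<le> (norm x * norm y)\<^sup>2"
    using qform_Cauchy_Schwarz[OF positive_op_id, of x y]
    by (simp add: qform_def cinner_self power_mult_distrib)
qed simp

lemma bounded_linear_cinner_right: "bounded_linear (cinner x)" for x :: "'h::chilbert_space"
proof (rule bounded_linear_intro[where K = "norm x"])
  show "norm (cinner x y) \<le> norm y * norm x" for y
    using norm_cinner_le[of x y] by (simp add: mult.commute)
qed (simp_all add: cinner_add_right cinner_scaleC_right scaleR_conv_of_real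
    scaleR_scaleC[where 'a = 'h])

section \<open>Orthonormal bases\<close>

text \<open>Split off from \<open>orthonormal_basis\<close> because it passes to finite subsets and
  is the property maximized by Zorn's lemma.\<close>

definition orthonormal :: "'h::chilbert_space set \<Rightarrow> bool"
  where "orthonormal B \<longleftrightarrow> (\<forall>e\<in>B. \<forall>f\<in>B. cinner e f = (if e = f then 1 else 0))"

lemma orthonormal_subset: "orthonormal B \<Longrightarrow> F \<subseteq> B \<Longrightarrow> orthonormal F"
  unfolding orthonormal_def by blast

lemma orthonormal_basis_imp_orthonormal: "orthonormal_basis B \<Longrightarrow> orthonormal B"
  unfolding orthonormal_basis_def orthonormal_def by blast

lemma orthonormal_norm:
  assumes "orthonormal B" "e \<in> B"
  shows "norm e = 1"
proof -
  have "complex_of_real ((norm e)\<^sup>2) = complex_of_real 1"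
    using assms unfolding cinner_self[symmetric] orthonormal_def by simp
  then have "(norm e)\<^sup>2 = 1"
    by (simp only: of_real_eq_iff)
  then show ?thesis
    by (simp add: power2_eq_1_iff) (metis norm_ge_zero not_one_le_zero neg_0_le_iff_le)
qed

lemma cinner_orthonormal_sum:
  assumes "orthonormal B" "finite F" "F \<subseteq> B" "e \<in> B"
  shows "cinner e (\<Sum>f\<in>F. c f *\<^sub>C f) = (if e \<in> F then c e else 0)"
proof -
  have "cinner e (\<Sum>f\<in>F. c f *\<^sub>C f) = (\<Sum>f\<in>F. if e = f then c f else 0)"
    unfolding cinner_sum_right
    using assms by (intro sum.cong refl) (auto simp: cinner_scaleC_right orthonormal_def subset_iff)
  then show ?thesis
    using assms(2) by simp
qed

lemma norm_orthonormal_sum: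
  assumes "orthonormal F" "finite F"
  shows "(norm (\<Sum>e\<in>F. c e *\<^sub>C e))\<^sup>2 = (\<Sum>e\<in>F. (norm (c e))\<^sup>2)"
proof -
  have "complex_of_real ((norm (\<Sum>e\<in>F. c e *\<^sub>C e))\<^sup>2)
      = (\<Sum>e\<in>F. cinner (c e *\<^sub>C e) (\<Sum>f\<in>F. c f *\<^sub>C f))"
    unfolding cinner_self[symmetric] by (rule cinner_sum_left)
  also have "\<dots> = (\<Sum>e\<in>F. cnj (c e) * c e)"
    using assms by (intro sum.cong refl) (simp add: cinner_scaleC_left cinner_orthonormal_sum)
  also have "\<dots> = complex_of_real (\<Sum>e\<in>F. (norm (c e))\<^sup>2)"
    by (simp only: of_real_sum complex_norm_square mult.commute)
  finally show ?thesis
    by (simp only: of_real_eq_iff)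
qed

text \<open>With \<open>p\<close> the orthogonal projection of \<open>x\<close> onto the span of
  \<open>F\<close>, the squared norm of \<open>x - p\<close> is the difference of the two
  sides.\<close>

lemma Bessel_inequality:
  assumes "orthonormal F" "finite F"
  shows "(\<Sum>e\<in>F. (norm (cinner e x))\<^sup>2) \<le> (norm x)\<^sup>2"
proof -
  define p where "p = (\<Sum>e\<in>F. cinner e x *\<^sub>C e)"
  have pp: "cinner p p = complex_of_real (\<Sum>e\<in>F. (norm (cinner e x))\<^sup>2)"
    unfolding cinner_self p_def by (simp only: norm_orthonormal_sum[OF assms])
  have "cinner p x = complex_of_real (\<Sum>e\<in>F. (norm (cinner e x))\<^sup>2)"
    by (simp add: p_def cinner_sum_left cinner_scaleC_left complex_norm_square mult.commute
        del: of_real_power)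
  then have px: "cinner p x = cinner p p" "cinner x p = cinner p p"
    using pp by (simp, subst cinner_commute, simp)
  have "complex_of_real ((norm (x - p))\<^sup>2) = cinner x x - cinner p p"
    unfolding cinner_self[symmetric] by (simp add: cinner_diff_left cinner_diff_right px)
  also have "\<dots> = complex_of_real ((norm x)\<^sup>2 - (\<Sum>e\<in>F. (norm (cinner e x))\<^sup>2))"
    unfolding pp by (simp add: cinner_self)
  finally have "(norm (x - p))\<^sup>2 = (norm x)\<^sup>2 - (\<Sum>e\<in>F. (norm (cinner e x))\<^sup>2)"
    by (simp only: of_real_eq_iff)
  then show ?thesis
    using zero_le_power2[of "norm (x - p)"] by linarith
qed

text \<open>By Bessel the squared coefficients are summable. By Pythagoras their tails are squared
  distances between partial expansions, which are therefore Cauchy and converge by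
  completeness.\<close>

lemma orthonormal_expansion_summable:
  fixes x :: "'h::chilbert_space"
  assumes B: "orthonormal B"
  shows "(\<lambda>e. cinner e x *\<^sub>C e) summable_on B"
proof -
  define g where "g F = (\<Sum>e\<in>F. cinner e x *\<^sub>C e)" for F
  define b where "b e = (norm (cinner e x))\<^sup>2" for e
  have "b summable_on B"
  proof (rule nonneg_bdd_above_summable_on)
    show "bdd_above (sum b ` {F. F \<subseteq> B \<and> finite F})"
      using B by (auto simp: b_def intro!: bdd_aboveI2 Bessel_inequality intro: orthonormal_subset)
  qed (simp add: b_def)
  then obtain s where s: "(b has_sum s) B"
    by (auto simp: summable_on_def)
  have "\<exists>P. eventually P (finite_subsets_at_top B) \<and>
      (\<forall>F G. P F \<and> P G \<longrightarrow> dist (g F) (g G) < \<epsilon>)" if "\<epsilon> > 0" for \<epsilon>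
  proof -
    \<comment> \<open>The tolerance is squared because tails of \<open>b\<close> are squared
      distances; two distances of at most a third of \<epsilon> stay strictly below
      \<epsilon>.\<close>
    have "(\<epsilon> / 3)\<^sup>2 > 0"
      using that by simp
    then obtain F0 where F0: "finite F0" "F0 \<subseteq> B" "dist (sum b F0) s \<le> (\<epsilon> / 3)\<^sup>2"
      using has_sum_finite_approximation[OF s] by blast
    define P where "P F \<longleftrightarrow> finite F \<and> F0 \<subseteq> F \<and> F \<subseteq> B" for F
    have near: "dist (g F) (g F0) \<le> \<epsilon> / 3" if "P F" for F
    proof -
      have F: "finite F" "F0 \<subseteq> F" "F \<subseteq> B"
        using that by (auto simp: P_def)
      have "g F - g F0 = (\<Sum>e\<in>F - F0. cinner e x *\<^sub>C e)"
        using F by (simp add: g_def sum_diff)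
      then have "(dist (g F) (g F0))\<^sup>2 = sum b (F - F0)"
        using F B by (simp add: dist_norm b_def norm_orthonormal_sum orthonormal_subset Diff_subset
            subset_trans[of "F - F0" F B])
      also have "\<dots> = sum b F - sum b F0"
        using F by (simp add: sum_diff)
      also have "\<dots> \<le> s - sum b F0"
        using finite_sum_le_has_sum[OF s F(1,3)] by (simp add: b_def)
      also have "\<dots> \<le> (\<epsilon> / 3)\<^sup>2"
        using F0(3) by (simp add: dist_real_def)
      finally show ?thesis
        by (rule power2_le_imp_le) (use \<open>\<epsilon> > 0\<close> in simp)
    qed
    have "eventually P (finite_subsets_at_top B)"
      using F0 by (auto simp: P_def eventually_finite_subsets_at_top)
    moreover have "dist (g F) (g G) < \<epsilon>" if "P F \<and> P G" for F G
      using near[of F] near[of G] that dist_triangle2[of "g F" "g G" "g F0"] \<open>\<epsilon> > 0\<close> by linarith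
    ultimately show ?thesis
      by blast
  qed
  then have "cauchy_filter (filtermap g (finite_subsets_at_top B))"
    by (simp add: cauchy_filter_metric_filtermap)
  then obtain y where "(g \<longlongrightarrow> y) (finite_subsets_at_top B)"
    using cauchy_filter_complete_converges[OF _ complete_UNIV, of "filtermap g (finite_subsets_at_top B)"]
    by (auto simp: filterlim_def filtermap_bot_iff)
  then show ?thesis
    unfolding summable_on_def has_sum_def g_def by blast
qed

text \<open>The difference between \<open>x\<close> and the sum of its expansion is orthogonal to
  every basis vector, so completeness of the basis makes it zero.\<close>

lemma orthonormal_basis_expansion:
  assumes B: "orthonormal_basis B"
  shows "((\<lambda>e. cinner e x *\<^sub>C e) has_sum x) B"
proof -
  have on: "orthonormal B"
    using B by (rule orthonormal_basis_imp_orthonormal)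
  obtain y where y: "((\<lambda>e. cinner e x *\<^sub>C e) has_sum y) B"
    using orthonormal_expansion_summable[OF on] by (auto simp: summable_on_def)
  have "cinner e (x - y) = 0" if e: "e \<in> B" for e
  proof -
    have "((\<lambda>f. cinner e (cinner f x *\<^sub>C f)) has_sum cinner e y) B"
      by (rule has_sum_bounded_linear[OF bounded_linear_cinner_right y])
    moreover have "((\<lambda>f. cinner e (cinner f x *\<^sub>C f)) has_sum cinner e x) B"
    proof -
      have "((\<lambda>f. cinner e (cinner f x *\<^sub>C f)) has_sum cinner e x) {e}"
        using on e by (intro has_sum_finiteI) (auto simp: cinner_scaleC_right orthonormal_def)
      then show ?thesis
        by (rule has_sum_cong_neutral[THEN iffD1, rotated -1])
          (use on e in \<open>auto simp: cinner_scaleC_right orthonormal_def\<close>)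
    qed
    ultimately show ?thesis
      by (simp add: cinner_diff_right has_sum_unique)
  qed
  then have "x - y = 0"
    using B unfolding orthonormal_basis_def by blast
  then show ?thesis
    using y by simp
qed

text \<open>The continuous functional \<open>cinner y\<close> is applied termwise to the expansion
  of \<open>x\<close>.\<close>

lemma Parseval:
  assumes "orthonormal_basis B"
  shows "((\<lambda>e. cinner e x * cinner y e) has_sum cinner y x) B"
  using has_sum_bounded_linear[OF bounded_linear_cinner_right orthonormal_basis_expansion[OF assms]]
  by (simp add: cinner_scaleC_right)

lemma Parseval_norm:
  assumes "orthonormal_basis B"
  shows "((\<lambda>e. (norm (cinner e x))\<^sup>2) has_sum (norm x)\<^sup>2) B"
proof -
  have "cinner e x * cinner x e = complex_of_real ((norm (cinner e x))\<^sup>2)" for e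
    by (subst (2) cinner_commute) (simp add: complex_norm_square del: of_real_power)
  then show ?thesis
    using Parseval[OF assms, of x x] unfolding cinner_self by (simp only: has_sum_of_real_iff)
qed

text \<open>A nonzero vector orthogonal to a maximal orthonormal set could be normalized and
  adjoined. Existence is what keeps \<open>has_trace\<close>, which quantifies over all bases, from
  holding vacuously, and so makes traces unique.\<close>

lemma orthonormal_basis_exists: "\<exists>B :: 'h::chilbert_space set. orthonormal_basis B"
proof -
  have "\<exists>M\<in>Collect orthonormal. \<forall>X\<in>Collect orthonormal. M \<subseteq> X \<longrightarrow> X = (M :: 'h set)"
  proof (rule subset_Zorn')
    fix C :: "'h set set"
    assume C: "subset.chain (Collect orthonormal) C"
    have "cinner e f = (if e = f then 1 else 0)" if "e \<in> \<Union>C" "f \<in> \<Union>C" for e f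
    proof -
      from that obtain X Y where XY: "X \<in> C" "Y \<in> C" "e \<in> X" "f \<in> Y"
        by blast
      then obtain Z where "Z \<in> C" "e \<in> Z" "f \<in> Z"
        using subset_chain_def C by (metis in_mono)
      moreover have "orthonormal Z"
        using C \<open>Z \<in> C\<close> by (auto simp: subset_chain_def)
      ultimately show ?thesis
        by (simp add: orthonormal_def)
    qed
    then show "\<Union>C \<in> Collect orthonormal"
      by (simp add: orthonormal_def)
  qed
  then obtain M :: "'h set" where M: "orthonormal M"
    and max: "\<And>X. orthonormal X \<Longrightarrow> M \<subseteq> X \<Longrightarrow> X = M"
    by auto
  have "x = 0" if x: "\<forall>e\<in>M. cinner e x = 0" for x
  proof (rule ccontr)
    assume "x \<noteq> 0"
    define u where "u = complex_of_real (1 / norm x) *\<^sub>C x"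
    have "norm u = 1"
      using \<open>x \<noteq> 0\<close> by (simp add: u_def norm_divide)
    then have uu: "cinner u u = 1"
      by (simp add: cinner_self)
    have eu: "cinner e u = 0" "cinner u e = 0" if "e \<in> M" for e
      using x that by (auto simp: u_def cinner_scaleC_right cinner_commute[of x e] cinner_scaleC_left)
    have "orthonormal (insert u M)"
      using M uu eu unfolding orthonormal_def by (metis insert_iff)
    then have "u \<in> M"
      using max by blast
    then show False
      using eu uu by force
  qed
  then have "orthonormal_basis M"
    using M unfolding orthonormal_basis_def orthonormal_def by blast
  then show ?thesis ..
qed

section \<open>Basis independence of traces\<close>

text \<open>Parseval expands \<open>qform T x\<close> over \<open>B\<close>. Cauchy--Schwarz for the
  form of \<open>T\<close> bounds each term, and Cauchy--Schwarz for finite sums, with Bessel,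
  bounds their total by \<open>c\<close>, which contains the square root of \<open>qform T x\<close>
  once.\<close>

lemma qform_le_trace:
  fixes T :: "'h::chilbert_space \<Rightarrow> 'h"
  assumes T: "positive_op T" and B: "orthonormal_basis B" and s: "(qform T has_sum s) B"
  shows "qform T x \<le> (norm x)\<^sup>2 * s"
proof -
  define c where "c = norm x * sqrt s * sqrt (qform T x)"
  have s0: "s \<ge> 0"
    using s has_sum_nonneg qform_nonneg[OF T] by metis
  have fin: "norm (\<Sum>e\<in>F. cinner e x * cinner (T x) e) \<le> c" if F: "finite F" "F \<subseteq> B" for F
  proof -
    have "norm (\<Sum>e\<in>F. cinner e x * cinner (T x) e)
      \<le> (\<Sum>e\<in>F. norm (cinner e x) * (sqrt (qform T e) * sqrt (qform T x)))"
    proof (rule sum_norm_le)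
      fix e
      have "norm (cinner (T x) e) \<le> sqrt (qform T e) * sqrt (qform T x)"
        using real_sqrt_le_mono[OF qform_Cauchy_Schwarz[OF T, of x e]]
        by (simp add: positive_op_symmetric[OF T] real_sqrt_mult mult.commute)
      then show "norm (cinner e x * cinner (T x) e)
          \<le> norm (cinner e x) * (sqrt (qform T e) * sqrt (qform T x))"
        by (simp add: norm_mult mult_left_mono)
    qed
    also have "\<dots> = (\<Sum>e\<in>F. \<bar>norm (cinner e x)\<bar> * \<bar>sqrt (qform T e)\<bar>) * sqrt (qform T x)"
      by (simp add: sum_distrib_right mult.assoc qform_nonneg[OF T])
    also have "\<dots> \<le> (L2_set (\<lambda>e. norm (cinner e x)) F * L2_set (\<lambda>e. sqrt (qform T e)) F) * sqrt (qform T x)"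
      by (intro mult_right_mono L2_set_mult_ineq) (simp add: qform_nonneg[OF T])
    also have "\<dots> \<le> (norm x * sqrt s) * sqrt (qform T x)"
    proof (intro mult_right_mono mult_mono)
      have "L2_set (\<lambda>e. norm (cinner e x)) F \<le> sqrt ((norm x)\<^sup>2)"
        unfolding L2_set_def using F orthonormal_subset[OF orthonormal_basis_imp_orthonormal[OF B]]
        by (intro real_sqrt_le_mono Bessel_inequality) auto
      then show "L2_set (\<lambda>e. norm (cinner e x)) F \<le> norm x"
        by simp
      have "sum (qform T) F \<le> s"
        using s F by (rule finite_sum_le_has_sum) (rule qform_nonneg[OF T])
      then show "L2_set (\<lambda>e. sqrt (qform T e)) F \<le> sqrt s"
        by (simp add: L2_set_def qform_nonneg[OF T])
    qed (simp_all add: qform_nonneg[OF T] s0)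
    finally show ?thesis
      by (simp add: c_def)
  qed
  have "((\<lambda>e. cinner e x * cinner (T x) e) has_sum complex_of_real (qform T x)) B"
    using Parseval[OF B, of x "T x"] by (simp add: positive_op_symmetric[OF T] cinner_eq_qform[OF T])
  then have "norm (complex_of_real (qform T x)) \<le> c"
    unfolding has_sum_def
    by (intro tendsto_upperbound[OF tendsto_norm])
      (auto intro!: eventually_finite_subsets_at_top_weakI fin)
  then have "sqrt (qform T x) * sqrt (qform T x) \<le> c"
    by (simp add: qform_nonneg[OF T])
  \<comment> \<open>One factor \<open>sqrt (qform T x)\<close> cancels; if it is zero the claim is
    trivial.\<close>
  then have "sqrt (qform T x) \<le> norm x * sqrt s"
    unfolding c_def using s0 qform_nonneg[OF T, of x]
    by (metis mult_right_le_imp_le real_sqrt_gt_zero order_le_less real_sqrt_zero mult_nonneg_nonneg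
        norm_ge_zero real_sqrt_ge_zero)
  then have "(sqrt (qform T x))\<^sup>2 \<le> (norm x * sqrt s)\<^sup>2"
    by (intro power_mono) (simp_all add: qform_nonneg[OF T])
  then show ?thesis
    using s0 by (simp add: qform_nonneg[OF T] power_mult_distrib)
qed

text \<open>
  One step of a Cholesky decomposition: subtracting the rank-one operator
  \<open>|T f\<rangle>\<langle>T f| / \<langle>f, T f\<rangle>\<close> preserves positivity.
\<close>

lemma positive_op_deflate:
  fixes T :: "'h::chilbert_space \<Rightarrow> 'h"
  assumes T: "positive_op T" and f: "qform T f > 0"
  defines "T1 \<equiv> \<lambda>x. T x - (cinner (T f) x / complex_of_real (qform T f)) *\<^sub>C T f"
  shows "positive_op T1"
    and "qform T1 x = qform T x - (norm (cinner (T f) x))\<^sup>2 / qform T f"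
proof -
  have q: "cinner x (T1 x) = complex_of_real (qform T x - (norm (cinner (T f) x))\<^sup>2 / qform T f)" for x
  proof -
    have "cinner (T f) x * cinner x (T f) = complex_of_real ((norm (cinner (T f) x))\<^sup>2)"
      by (subst (2) cinner_commute) (simp only: complex_norm_square)
    then show ?thesis
      by (simp add: T1_def cinner_diff_right cinner_scaleC_right cinner_eq_qform[OF T])
  qed
  \<comment> \<open>Positivity of the remainder is exactly Cauchy--Schwarz for \<open>T\<close> at
    \<open>x\<close> and \<open>f\<close>.\<close>
  have "0 \<le> qform T x - (norm (cinner (T f) x))\<^sup>2 / qform T f" for x
    using qform_Cauchy_Schwarz[OF T, of x f] f norm_cinner_commute[of "T f" x]
    by (simp add: field_simps)
  moreover have "T1 (x + y) = T1 x + T1 y" for x y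
  proof -
    have "T1 x + T1 y = T x + T y - ((cinner (T f) x / complex_of_real (qform T f)) *\<^sub>C T f
        + (cinner (T f) y / complex_of_real (qform T f)) *\<^sub>C T f)"
      by (simp add: T1_def)
    then show ?thesis
      by (simp add: T1_def positive_op_add[OF T] cinner_add_right add_divide_distrib
          flip: scaleC_add_left)
  qed
  moreover have "T1 (c *\<^sub>C x) = c *\<^sub>C T1 x" for c x
  proof -
    have "c *\<^sub>C (y - z) = c *\<^sub>C y - c *\<^sub>C z" for y z :: 'h
      using scaleC_add_right[of c "y - z" z] by (simp add: algebra_simps)
    then show ?thesis
      by (simp add: T1_def positive_op_scaleC[OF T] cinner_scaleC_right scaleC_scaleC)
  qed
  ultimately show "positive_op T1"
    using q by (intro positive_opI)
  show "qform T1 x = qform T x - (norm (cinner (T f) x))\<^sup>2 / qform T f"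
    unfolding qform_def[of T1] q by simp
qed

text \<open>Induction over the vectors split off, with \<open>T\<close> arbitrary because each step
  replaces it by its remainder. Rank-one pieces obey the sharp bound; what is left obeys only a
  crude one, whose factor \<open>card G\<close> multiplies the trace outside
  \<open>F\<close>.\<close>

lemma sum_qform_le_tail:
  fixes T S S' :: "'h::chilbert_space \<Rightarrow> 'h"
  assumes B: "orthonormal_basis B"
    and adj: "\<And>x y. cinner (S x) y = cinner x (S' y)"
    and bound: "\<And>x. norm (S x) \<le> K * norm x" "\<And>x. norm (S' x) \<le> K * norm x"
    and G: "orthonormal G" "finite G"
  shows "finite F \<Longrightarrow> F \<subseteq> B \<Longrightarrow> positive_op T \<Longrightarrow> qform T summable_on B \<Longrightarrow>
    (\<Sum>e\<in>G. qform T (S e))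
      \<le> K\<^sup>2 * (infsum (qform T) B + real (card G) * infsum (qform T) (B - F))"
proof (induction F arbitrary: T rule: finite_induct)
  case empty
  note T = \<open>positive_op T\<close>
  \<comment> \<open>With nothing split off the tail is the whole trace, so the crude bound on each
    of the \<open>card G\<close> terms suffices.\<close>
  have "qform T (S e) \<le> K\<^sup>2 * infsum (qform T) B" if "e \<in> G" for e
  proof -
    have "(norm (S e))\<^sup>2 \<le> K\<^sup>2"
      using bound(1)[of e] orthonormal_norm[OF G(1) that] by (simp add: power_mono)
    then have "(norm (S e))\<^sup>2 * infsum (qform T) B \<le> K\<^sup>2 * infsum (qform T) B"
      by (intro mult_right_mono infsum_nonneg qform_nonneg[OF T])
    then show ?thesis
      using qform_le_trace[OF T B has_sum_infsum[OF empty(3)], of "S e"] by linarith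
  qed
  then have "(\<Sum>e\<in>G. qform T (S e)) \<le> real (card G) * (K\<^sup>2 * infsum (qform T) B)"
    by (rule sum_bounded_above)
  moreover have "0 \<le> K\<^sup>2 * infsum (qform T) B"
    by (simp add: infsum_nonneg qform_nonneg[OF T])
  ultimately show ?case
    by (simp add: algebra_simps)
next
  case (insert f F)
  note T = insert.prems(2) and sm = insert.prems(3)
  have f: "f \<in> B" "f \<notin> F" "F \<subseteq> B"
    using insert by auto
  show ?case
  proof (cases "qform T f = 0")
    case True
    have "infsum (qform T) (B - F) = infsum (qform T) (B - insert f F)"
      by (rule infsum_cong_neutral) (use True in auto)
    then show ?thesis
      using insert.IH[OF f(3) T sm] by simp
  next
    case False
    define a where "a = qform T f"
    define T1 where "T1 = (\<lambda>x. T x - (cinner (T f) x / complex_of_real (qform T f)) *\<^sub>C T f)"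
    have a: "a > 0"
      using False qform_nonneg[OF T, of f] by (simp add: a_def)
    then have T1: "positive_op T1"
      and q1: "qform T1 x = qform T x - (norm (cinner (T f) x))\<^sup>2 / a" for x
      using positive_op_deflate[OF T, of f] by (simp_all add: a_def T1_def)
    \<comment> \<open>Parseval computes the trace of the rank-one piece, which is the amount by
      which the trace drops.\<close>
    have "((\<lambda>e. (norm (cinner (T f) e))\<^sup>2) has_sum (norm (T f))\<^sup>2) B"
      using Parseval_norm[OF B, of "T f"] by (simp add: norm_cinner_commute[of _ "T f"])
    then have "((\<lambda>e. qform T e + - ((1 / a) * (norm (cinner (T f) e))\<^sup>2)) has_sum
        infsum (qform T) B + - ((1 / a) * (norm (T f))\<^sup>2)) B"
      by (intro has_sum_add has_sum_infsum sm has_sum_uminusI has_sum_cmult_right)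
    then have sum1: "(qform T1 has_sum infsum (qform T) B - (norm (T f))\<^sup>2 / a) B"
      by (simp add: q1[abs_def])
    have sm1: "qform T1 summable_on B"
      using sum1 by (auto simp: summable_on_def)
    \<comment> \<open>The form of \<open>T1\<close> vanishes at \<open>f\<close> and is below that
      of \<open>T\<close> elsewhere, so the induction hypothesis for \<open>F\<close> yields the
      tail for \<open>insert f F\<close>.\<close>
    have tail: "infsum (qform T1) (B - F) \<le> infsum (qform T) (B - insert f F)"
    proof -
      have "cinner (T f) f = complex_of_real a"
        by (simp add: positive_op_symmetric[OF T] cinner_eq_qform[OF T] a_def)
      then have "qform T1 f = 0"
        using a by (simp add: q1 power2_eq_square flip: a_def)
      then have "infsum (qform T1) (B - F) = infsum (qform T1) (B - insert f F)"
        by (intro infsum_cong_neutral) auto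
      also have "\<dots> \<le> infsum (qform T) (B - insert f F)"
        using a by (intro infsum_mono summable_on_subset_banach[OF sm] summable_on_subset_banach[OF sm1])
          (auto simp: q1)
      finally show ?thesis .
    qed
    \<comment> \<open>Moving \<open>S\<close> to its adjoint allows Bessel over \<open>G\<close>.
      After division by \<open>a\<close> this is at most the drop in trace times
      \<open>K\<^sup>2\<close>, so the main term is restored without loss.\<close>
    have "(\<Sum>e\<in>G. (norm (cinner (T f) (S e)))\<^sup>2) \<le> K\<^sup>2 * (norm (T f))\<^sup>2"
    proof -
      have "(\<Sum>e\<in>G. (norm (cinner (T f) (S e)))\<^sup>2) = (\<Sum>e\<in>G. (norm (cinner e (S' (T f))))\<^sup>2)"
        by (simp add: norm_cinner_commute[of "T f"] adj)
      also have "\<dots> \<le> (norm (S' (T f)))\<^sup>2"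
        by (rule Bessel_inequality[OF G])
      also have "\<dots> \<le> (K * norm (T f))\<^sup>2"
        by (intro power_mono bound) simp
      finally show ?thesis
        by (simp add: power_mult_distrib)
    qed
    then have "(\<Sum>e\<in>G. (norm (cinner (T f) (S e)))\<^sup>2) / a \<le> K\<^sup>2 * (norm (T f))\<^sup>2 / a"
      using a by (intro divide_right_mono) simp_all
    moreover have "(\<Sum>e\<in>G. qform T (S e))
        = (\<Sum>e\<in>G. qform T1 (S e)) + (\<Sum>e\<in>G. (norm (cinner (T f) (S e)))\<^sup>2) / a"
      by (simp add: q1 sum_subtractf sum_divide_distrib)
    moreover have "(\<Sum>e\<in>G. qform T1 (S e))
        \<le> K\<^sup>2 * (infsum (qform T) B - (norm (T f))\<^sup>2 / a + real (card G) * infsum (qform T1) (B - F))"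
      using insert.IH[OF f(3) T1 sm1] infsumI[OF sum1] by simp
    moreover have "K\<^sup>2 * (real (card G) * infsum (qform T1) (B - F))
        \<le> K\<^sup>2 * (real (card G) * infsum (qform T) (B - insert f F))"
      by (intro mult_left_mono tail) simp_all
    ultimately show ?thesis
      by (simp add: algebra_simps)
  qed
qed

text \<open>\<open>G\<close> is fixed while the tail of the trace outside \<open>F\<close> can be
  made arbitrarily small, so the error term disappears.\<close>

lemma sum_qform_le:
  fixes T S S' :: "'h::chilbert_space \<Rightarrow> 'h"
  assumes T: "positive_op T" and B: "orthonormal_basis B" and s: "(qform T has_sum s) B"
    and adj: "\<And>x y. cinner (S x) y = cinner x (S' y)"
    and bound: "\<And>x. norm (S x) \<le> K * norm x" "\<And>x. norm (S' x) \<le> K * norm x"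
    and G: "orthonormal G" "finite G"
  shows "(\<Sum>e\<in>G. qform T (S e)) \<le> K\<^sup>2 * s"
proof (rule field_le_epsilon)
  fix \<epsilon> :: real
  assume \<epsilon>: "\<epsilon> > 0"
  define c where "c = K\<^sup>2 * real (card G)"
  have c: "c \<ge> 0"
    by (simp add: c_def)
  \<comment> \<open>The denominator is \<open>c + 1\<close> because \<open>c\<close> may be
    zero.\<close>
  then obtain F where F: "finite F" "F \<subseteq> B" "dist (sum (qform T) F) s \<le> \<epsilon> / (c + 1)"
    using has_sum_finite_approximation[OF s, of "\<epsilon> / (c + 1)"] \<epsilon> by auto
  have sm: "qform T summable_on B" and inf: "infsum (qform T) B = s"
    using s by (auto simp: summable_on_def infsumI)
  have "infsum (qform T) (B - F) = s - sum (qform T) F"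
    using infsum_Diff[OF sm, of F] F inf by simp
  then have "infsum (qform T) (B - F) \<le> \<epsilon> / (c + 1)"
    using F(3) by (simp add: dist_real_def)
  then have "c * infsum (qform T) (B - F) \<le> c * (\<epsilon> / (c + 1))"
    using c by (rule mult_left_mono)
  also have "\<dots> \<le> \<epsilon>"
    using c \<epsilon> by (simp add: field_simps)
  finally show "(\<Sum>e\<in>G. qform T (S e)) \<le> K\<^sup>2 * s + \<epsilon>"
    using sum_qform_le_tail[OF B adj bound G F(1,2) T sm] inf by (simp add: c_def algebra_simps)
qed

text \<open>The partial-sum bound for \<open>T\<close> makes the form of \<open>T'\<close> summable
  over every basis. The same bound for \<open>T'\<close>, with the identity and
  \<open>K = 1\<close>, compares its sums over two bases in both directions.\<close>

lemma qform_has_sum_basis_independent: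
  fixes T S S' :: "'h::chilbert_space \<Rightarrow> 'h"
  assumes T: "positive_op T" and B: "orthonormal_basis B" and s: "(qform T has_sum s) B"
    and lin: "clinear S" "clinear S'"
    and adj: "\<And>x y. cinner (S x) y = cinner x (S' y)"
    and bound: "\<And>x. norm (S x) \<le> K * norm x" "\<And>x. norm (S' x) \<le> K * norm x"
  shows "\<exists>t. \<forall>B'. orthonormal_basis B' \<longrightarrow> ((\<lambda>e. qform T (S e)) has_sum t) B'"
proof -
  define T' where "T' = (\<lambda>x. S' (T (S x)))"
  have T'e: "qform T' x = qform T (S x)" for x
    by (simp add: qform_def T'_def adj)
  have T': "positive_op T'"
    by (rule positive_opI[where q = "qform T'"])
      (use lin in \<open>simp_all add: T'e qform_nonneg[OF T] flip: cinner_eq_qform[OF T] adj,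
        simp_all add: T'_def clinear_iff positive_op_add[OF T] positive_op_scaleC[OF T] adj\<close>)
  have sm: "qform T' summable_on C" if C: "orthonormal_basis C" for C
  proof (rule nonneg_bdd_above_summable_on[OF qform_nonneg[OF T']])
    show "bdd_above (sum (qform T') ` {F. F \<subseteq> C \<and> finite F})"
      using sum_qform_le[OF T B s adj bound]
        orthonormal_subset[OF orthonormal_basis_imp_orthonormal[OF C]]
      by (auto simp: T'e intro!: bdd_aboveI2)
  qed
  have le: "infsum (qform T') C \<le> infsum (qform T') D"
    if C: "orthonormal_basis C" and D: "orthonormal_basis D" for C D
  proof (rule infsum_le_finite_sums[OF sm[OF C]])
    fix F
    assume "finite F" "F \<subseteq> C"
    then show "sum (qform T') F \<le> infsum (qform T') D"
      using sum_qform_le[OF T' D has_sum_infsum[OF sm[OF D]], where S = "\<lambda>x. x" and S' = "\<lambda>x. x"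
          and K = 1 and G = F] orthonormal_subset[OF orthonormal_basis_imp_orthonormal[OF C]]
      by simp
  qed
  have "((\<lambda>e. qform T (S e)) has_sum infsum (qform T') B) C" if C: "orthonormal_basis C" for C
    using has_sum_infsum[OF sm[OF C]] le[OF B C] le[OF C B] by (simp add: T'e[abs_def])
  then show ?thesis
    by blast
qed

section \<open>The Hellinger--Toeplitz theorem\<close>

text \<open>Uniform boundedness for the functionals \<open>cinner (A y)\<close> with
  \<open>y\<close> in the unit ball: by symmetry they are bounded at each \<open>x\<close> by
  \<open>norm (A x)\<close>. Baire's theorem then gives a common bound \<open>n\<close> on some
  ball.\<close>

lemma hermitian_bounded:
  fixes A :: "'h::chilbert_space \<Rightarrow> 'h"
  assumes A: "hermitian A"
  obtains K where "\<And>x. norm (A x) \<le> K * norm x"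
proof -
  have lin: "A (c *\<^sub>C x) = c *\<^sub>C A x" and sym: "cinner (A x) y = cinner x (A y)" for c x y
    using A by (auto simp: hermitian_def clinear_iff)
  define E :: "nat \<Rightarrow> 'h set"
    where "E n = (\<Inter>y\<in>cball 0 1. {x. norm (cinner (A y) x) \<le> real n})" for n
  have closed: "closed (E n)" for n
    unfolding E_def
    by (intro closed_INT ballI closed_Collect_le continuous_intros
        bounded_linear.continuous_on[OF bounded_linear_cinner_right])
  have cover: "(\<Union>n. E n) = UNIV"
  proof -
    have "\<exists>n. x \<in> E n" for x
    proof -
      obtain n where n: "norm (A x) \<le> real n"
        using real_arch_simple by blast
      have "norm (cinner (A y) x) \<le> real n" if "norm y \<le> 1" for y
      proof -
        have "norm (cinner (A y) x) \<le> norm y * norm (A x)"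
          unfolding sym by (rule norm_cinner_le)
        also have "\<dots> \<le> norm (A x)"
          using that by (simp add: mult_left_le_one_le)
        finally show ?thesis
          using n by simp
      qed
      then show ?thesis
        unfolding E_def by (intro exI[of _ n]) auto
    qed
    then show ?thesis
      by blast
  qed
  have "\<exists>n. interior (E n) \<noteq> {}"
  proof (rule ccontr)
    assume "\<not> (\<exists>n. interior (E n) \<noteq> {})"
    \<comment> \<open>By Baire, countably many closed sets with empty interior cannot cover the
      complete space.\<close>
    then have "Met_TC.mtopology interior_of \<Union>(range E) = {}"
      using closed
      by (intro Met_TC.metric_Baire_category_alt)
        (auto simp: complete_UNIV closed_closedin[symmetric])
    then show False
      using cover by simp
  qed
  then obtain n x0 r where r: "r > 0" and ball: "ball x0 r \<subseteq> E n"
    by (metis all_not_in_conv mem_interior)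
  have unit: "norm (A y) \<le> 4 * real n / r" if y: "norm y \<le> 1" for y
  proof (cases "A y = 0")
    case True
    then show ?thesis
      using r by simp
  next
    case False
    \<comment> \<open>A vector of length \<open>r / 2\<close> along \<open>A y\<close>: both
      \<open>x0\<close> and \<open>x0 + w\<close> lie in the ball, and the difference of the
      functional's values there is \<open>r / 2 * norm (A y)\<close>.\<close>
    define w where "w = complex_of_real (r / 2 / norm (A y)) *\<^sub>C A y"
    have "norm w < r"
      using r False by (simp add: w_def norm_divide norm_mult)
    then have "x0 + w \<in> E n" "x0 \<in> E n"
      using ball r by (auto simp: subset_iff dist_norm)
    then have "norm (cinner (A y) (x0 + w)) \<le> real n" "norm (cinner (A y) x0) \<le> real n"
      using y by (auto simp: E_def)
    then have "norm (cinner (A y) (x0 + w) - cinner (A y) x0) \<le> 2 * real n"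
      using norm_triangle_ineq4[of "cinner (A y) (x0 + w)" "cinner (A y) x0"] by linarith
    moreover have "cinner (A y) (x0 + w) - cinner (A y) x0 = complex_of_real (r / 2 * norm (A y))"
      using False
      by (simp add: cinner_add_right w_def cinner_scaleC_right cinner_self power2_eq_square)
    ultimately have "r / 2 * norm (A y) \<le> 2 * real n"
      using r by (simp only: norm_of_real)
    then show ?thesis
      using r by (simp add: field_simps)
  qed
  have "norm (A x) \<le> 4 * real n / r * norm x" for x
  proof (cases "x = 0")
    case True
    then show ?thesis
      using lin[of 0 x] by simp
  next
    case False
    then show ?thesis
      using unit[of "complex_of_real (1 / norm x) *\<^sub>C x"]
      by (simp add: lin norm_divide field_simps)
  qed
  then show ?thesis
    by (rule that)
qed

section \<open>Expectation values\<close>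

lemma Tr_eqI:
  assumes "has_trace T t"
  shows "Tr T = t"
  unfolding Tr_def
proof (rule the_equality)
  show "has_trace T t"
    by (rule assms)
  fix u
  assume "has_trace T u"
  then show "u = t"
    using assms orthonormal_basis_exists has_sum_unique unfolding has_trace_def by metis
qed

text \<open>Since the form is real, \<open>x + y\<close> yields the real part, and
  \<open>x + \<i> *\<^sub>C y\<close> yields minus the imaginary part because
  \<open>Re (\<i> * z) = - Im z\<close>.\<close>

lemma cinner_polarization:
  fixes T :: "'h::chilbert_space \<Rightarrow> 'h"
  assumes T: "positive_op T"
  shows "cinner x (T y) = complex_of_real ((qform T (x + y) - qform T x - qform T y) / 2)
    - \<i> * complex_of_real ((qform T (x + \<i> *\<^sub>C y) - qform T x - qform T y) / 2)"
  using qform_add_scaleC[OF T, of x 1 y] qform_add_scaleC[OF T, of x \<i> y]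
  by (simp add: complex_eq_iff)

lemma has_trace_density_hermitian:
  fixes \<rho> A :: "'h::chilbert_space \<Rightarrow> 'h"
  assumes \<rho>: "\<rho> \<in> density_operators" and A: "hermitian A"
  shows "\<exists>t. has_trace (\<rho> \<circ> A) t"
proof -
  have T: "positive_op \<rho>" and tr: "has_trace \<rho> 1"
    using \<rho> by (auto simp: density_operators_def)
  obtain B :: "'h set" where B: "orthonormal_basis B"
    using orthonormal_basis_exists by blast
  have "((\<lambda>e. complex_of_real (qform \<rho> e)) has_sum complex_of_real 1) B"
    using tr B by (simp add: has_trace_def cinner_eq_qform[OF T])
  then have s: "(qform \<rho> has_sum 1) B"
    by (simp only: has_sum_of_real_iff)
  obtain K where K: "\<And>x. norm (A x) \<le> K * norm x"
    using hermitian_bounded[OF A] by blast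
  have sym: "cinner (A x) y = cinner x (A y)" for x y
    using A by (simp add: hermitian_def)
  have linA: "A (x + y) = A x + A y" "A (c *\<^sub>C x) = c *\<^sub>C A x" for x y c
    using A by (auto simp: hermitian_def clinear_iff)
  \<comment> \<open>One family \<open>a + b A\<close> covers all the forms in the polarization
    identity. As \<open>A\<close> is Hermitian, the adjoint is \<open>cnj a + cnj b A\<close>, under
    the same norm bound.\<close>
  have conj: "\<exists>t. \<forall>B'. orthonormal_basis B' \<longrightarrow> ((\<lambda>e. qform \<rho> (a *\<^sub>C e + b *\<^sub>C A e)) has_sum t) B'"
    for a b :: complex
  proof (rule qform_has_sum_basis_independent[OF T B s])
    show "clinear (\<lambda>e. a *\<^sub>C e + b *\<^sub>C A e)" "clinear (\<lambda>e. cnj a *\<^sub>C e + cnj b *\<^sub>C A e)"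
      by (simp_all add: clinear_iff linA scaleC_add_right scaleC_scaleC mult.commute add_ac)
    show "cinner (a *\<^sub>C x + b *\<^sub>C A x) y = cinner x (cnj a *\<^sub>C y + cnj b *\<^sub>C A y)" for x y
      by (simp add: cinner_add_left cinner_add_right cinner_scaleC_left cinner_scaleC_right sym)
    have *: "norm (c *\<^sub>C x + d *\<^sub>C A x) \<le> (norm c + norm d * K) * norm x" for c d x
    proof -
      have "norm (c *\<^sub>C x + d *\<^sub>C A x) \<le> norm c * norm x + norm d * norm (A x)"
        using norm_triangle_ineq[of "c *\<^sub>C x" "d *\<^sub>C A x"] by simp
      also have "\<dots> \<le> norm c * norm x + norm d * (K * norm x)"
        by (intro add_left_mono mult_left_mono K) simp
      finally show ?thesis
        by (simp add: algebra_simps)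
    qed
    show "norm (a *\<^sub>C x + b *\<^sub>C A x) \<le> (norm a + norm b * K) * norm x"
      and "norm (cnj a *\<^sub>C x + cnj b *\<^sub>C A x) \<le> (norm a + norm b * K) * norm x" for x
      using *[of a x b] *[of "cnj a" x "cnj b"] by simp_all
  qed
  obtain t1 where t1: "\<And>B'. orthonormal_basis B' \<Longrightarrow> (qform \<rho> has_sum t1) B'"
    using conj[of 1 0] by auto
  obtain t2 where t2: "\<And>B'. orthonormal_basis B' \<Longrightarrow> ((\<lambda>e. qform \<rho> (A e)) has_sum t2) B'"
    using conj[of 0 1] by auto
  obtain t3 where t3: "\<And>B'. orthonormal_basis B' \<Longrightarrow> ((\<lambda>e. qform \<rho> (e + A e)) has_sum t3) B'"
    using conj[of 1 1] by auto
  obtain t4 where t4: "\<And>B'. orthonormal_basis B' \<Longrightarrow> ((\<lambda>e. qform \<rho> (e + \<i> *\<^sub>C A e)) has_sum t4) B'"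
    using conj[of 1 \<i>] by auto
  have diff: "((\<lambda>e. f e - g e) has_sum u - v) C" if "(f has_sum u) C" "(g has_sum v) C"
    for f g :: "'h \<Rightarrow> 'b::real_normed_algebra_1" and u v C
    using has_sum_add[OF that(1) has_sum_uminusI[OF that(2)]] by simp
  \<comment> \<open>Halving is written as multiplication so that the rules for scalar multiples of
    sums apply.\<close>
  have "has_trace (\<rho> \<circ> A) (complex_of_real ((t3 - t1 - t2) * (1/2)) - \<i> * complex_of_real ((t4 - t1 - t2) * (1/2)))"
    unfolding has_trace_def
  proof (intro allI impI)
    fix C :: "'h set"
    assume C: "orthonormal_basis C"
    have "((\<lambda>e. complex_of_real ((qform \<rho> (e + A e) - qform \<rho> e - qform \<rho> (A e)) * (1/2))
      - \<i> * complex_of_real ((qform \<rho> (e + \<i> *\<^sub>C A e) - qform \<rho> e - qform \<rho> (A e)) * (1/2)))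
      has_sum (complex_of_real ((t3 - t1 - t2) * (1/2)) - \<i> * complex_of_real ((t4 - t1 - t2) * (1/2)))) C"
      by (intro diff has_sum_cmult_right has_sum_cmult_left has_sum_of_real t1 t2 t3 t4 C)
    then show "((\<lambda>e. cinner e ((\<rho> \<circ> A) e)) has_sum
        complex_of_real ((t3 - t1 - t2) * (1/2)) - \<i> * complex_of_real ((t4 - t1 - t2) * (1/2))) C"
      by (simp add: cinner_polarization[OF T])
  qed
  then show ?thesis
    by blast
qed

text \<open>\<open>Tr\<close> is a definite description, so linearity is obtained at the level of
  \<open>has_trace\<close>, once a trace of \<open>\<rho> \<circ> A\<close> is known to exist. The
  unit trace of \<open>\<rho>\<close> turns the subtracted multiple of the identity into
  \<open>m\<close>.\<close>

lemma Tr_density_shift: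
  fixes \<rho> A :: "'h::chilbert_space \<Rightarrow> 'h"
  assumes \<rho>: "\<rho> \<in> density_operators" and A: "hermitian A"
  shows "Tr (\<rho> \<circ> (\<lambda>x. A x - m *\<^sub>C x)) = Tr (\<rho> \<circ> A) - m"
proof -
  have T: "positive_op \<rho>" and tr: "has_trace \<rho> 1"
    using \<rho> by (auto simp: density_operators_def)
  obtain t where t: "has_trace (\<rho> \<circ> A) t"
    using has_trace_density_hermitian[OF \<rho> A] by blast
  have eq: "cinner e (\<rho> (A e - m *\<^sub>C e)) = cinner e (\<rho> (A e)) + (- m) * cinner e (\<rho> e)" for e
  proof -
    have "A e - m *\<^sub>C e = A e + (- m) *\<^sub>C e"
      using scaleC_add_left[of "- m" m e] by (simp add: algebra_simps)
    then show ?thesis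
      by (simp only: positive_op_add[OF T] positive_op_scaleC[OF T] cinner_add_right
          cinner_scaleC_right)
  qed
  have "has_trace (\<rho> \<circ> (\<lambda>x. A x - m *\<^sub>C x)) (t + (- m) * 1)"
    unfolding has_trace_def comp_def eq
    using t tr by (intro allI impI has_sum_add has_sum_cmult_right) (auto simp: has_trace_def)
  then show ?thesis
    using Tr_eqI[OF t] Tr_eqI by force
qed

section \<open>The proxy witness property of the shifted observable\<close>

theorem lemma2:
  fixes P :: "('h::chilbert_space \<Rightarrow> 'h) \<Rightarrow> bool"
    and C :: "('h \<Rightarrow> 'h) set"
    and A :: "'h \<Rightarrow> 'h"
  assumes "C = states_lacking P"
    and "hermitian A"
    and min_exists: "\<exists>\<rho>\<in>C. \<forall>\<sigma>\<in>C. Tr (\<rho> \<circ> A) \<le> Tr (\<sigma> \<circ> A)"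
  shows "(\<forall>\<rho>\<in>C. 0 \<le> Tr (\<rho> \<circ> Z_PW A C)) \<and>
    (\<forall>\<xi>\<in>density_operators. Tr (\<xi> \<circ> Z_PW A C) < 0 \<longrightarrow> P \<xi>)"
proof -
  obtain \<tau> where \<tau>: "\<tau> \<in> C" "\<And>\<sigma>. \<sigma> \<in> C \<Longrightarrow> Tr (\<tau> \<circ> A) \<le> Tr (\<sigma> \<circ> A)"
    using min_exists by blast
  \<comment> \<open>The order on complex numbers is only partial; the attained minimum at \<tau> is
    comparable with every other value and so identifies the \<open>LEAST\<close> element.\<close>
  have m: "min_expectation A C = Tr (\<tau> \<circ> A)"
    unfolding min_expectation_def using \<tau> by (intro Least_equality) auto
  have nonneg: "0 \<le> Tr (\<rho> \<circ> Z_PW A C)" if "\<rho> \<in> C" for \<rho>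
  proof -
    have "\<rho> \<in> density_operators"
      using that assms(1) by (simp add: states_lacking_def)
    then have "Tr (\<rho> \<circ> Z_PW A C) = Tr (\<rho> \<circ> A) - Tr (\<tau> \<circ> A)"
      unfolding Z_PW_def m by (rule Tr_density_shift[OF _ assms(2)])
    then show ?thesis
      using \<tau>(2)[OF that] by (simp add: less_eq_complex_def)
  qed
  moreover have "P \<xi>" if "\<xi> \<in> density_operators" "Tr (\<xi> \<circ> Z_PW A C) < 0" for \<xi>
  proof (rule ccontr)
    assume "\<not> P \<xi>"
    then have "\<xi> \<in> C"
      using that(1) assms(1) by (simp add: states_lacking_def)
    then show False
      using nonneg[of \<xi>] that(2) by simp
  qed
  ultimately show ?thesis
    by (intro conjI ballI impI)
qed

end
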